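(* Let $K$ be a field, $S=K[x_1,\ldots,x_n]$, $s\ge 2$, and let $I=\bigcap_{i=1}^s P_i$ be an irredundant intersection of monomial prime ideals of $S$ with $\sum_{i=1}^s P_i=\mathfrak m:=(x_1,\ldots,x_n)$. If the big size of $I$ is $1$, then $\operatorname{sdepth}_S I\geq 2$, that is, Stanley's Conjecture $\operatorname{sdepth}_S I\ge\operatorname{depth}_S I$ holds for $I$.
   Context: A monomial prime ideal of $S$ is an ideal generated by a subset of the variables; an intersection $\bigcap_i P_i$ is irredundant if no $P_i$ can be omitted without changing it. Big size: for $I=\bigcap_{i=1}^s P_i$ as in the claim, with $\sum_{i=1}^sP_i=\mathfrak m$, the big size $t(I)$ is the minimal number $t<s$ such that the sum of any $t+1$ (distinct) prime ideals among $P_1,\ldots,P_s$ equals $\mathfrak m$. For a nonzero monomial ideal $I\subset S$, a monomial $u\in I$ and $Z\subset\{x_1,\ldots,x_n\}$, $uK[Z]$ denotes the $K$-linear subspace generated by all $uf$ with $f\in K[Z]$. A Stanley decomposition of $I$ is a presentation $\mathcal D:\ I=\bigoplus_{i=1}^r u_iK[Z_i]$ as a finite direct sum of $K$-subspaces, with $u_i\in I$ monomials and $Z_i\subset\{x_1,\ldots,x_n\}$. Set $\operatorname{sdepth}(\mathcal D)=\min_i|Z_i|$, and let $\operatorname{sdepth}_S I$ be the maximum of $\operatorname{sdepth}(\mathcal D)$ over all Stanley decompositions of $I$. $\operatorname{depth}_S I$ is the depth of the $S$-module $I$ with respect to $\mathfrak m$. *)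

theory Defs
  imports
    Complex_Main
    "HOL-Library.Poly_Mapping"
    "HOL-Library.Set_Algebras"
    "HOL-Library.Extended_Nat"
begin

text \<open>
  Monomials in the variables indexed by the finite type \<open>'n\<close> are exponent vectors, and
  \<open>K[x\<^sub>1, \<dots>, x\<^sub>n]\<close> is the monoid algebra of the monomials over the field \<open>'k\<close>, with the
  convolution product of \<open>Poly_Mapping\<close>. Here \<open>n = CARD('n)\<close>.
\<close>

type_synonym 'n monom = "'n \<Rightarrow>\<^sub>0 nat"
type_synonym ('n, 'k) mpoly = "'n monom \<Rightarrow>\<^sub>0 'k"

definition monomial :: "'n monom \<Rightarrow> ('n, 'k::field) mpoly" where
  "monomial u = Poly_Mapping.single u 1"

definition var :: "'n \<Rightarrow> ('n, 'k::field) mpoly" where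
  "var j = monomial (Poly_Mapping.single j 1)"

definition scalar :: "'k::field \<Rightarrow> ('n, 'k) mpoly \<Rightarrow> ('n, 'k) mpoly" where
  "scalar c f = Poly_Mapping.single 0 c * f"

text \<open>
  Ideals of a commutative ring are its submodules when it acts on itself by multiplication, so
  \<open>ideal.span A\<close> is the ideal generated by \<open>A\<close>. Likewise \<open>lin.span A\<close> is the \<open>K\<close>-linear
  subspace of the polynomial ring generated by \<open>A\<close>.
\<close>

global_interpretation ideal: module "(*) :: 'a::comm_ring_1 \<Rightarrow> 'a \<Rightarrow> 'a"
  by standard (simp_all add: algebra_simps)

global_interpretation lin: vector_space "scalar :: 'k::field \<Rightarrow> ('n, 'k) mpoly \<Rightarrow> ('n, 'k) mpoly"
proof
  fix a b :: 'k and x y :: "('n, 'k) mpoly"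
  show "scalar a (x + y) = scalar a x + scalar a y"
    by (simp add: scalar_def distrib_left)
  show "scalar (a + b) x = scalar a x + scalar b x"
    by (simp add: scalar_def single_add distrib_right)
  show "scalar a (scalar b x) = scalar (a * b) x"
    by (simp add: scalar_def mult.assoc [symmetric] mult_single)
  show "scalar 1 x = x"
    by (simp add: scalar_def)
qed

definition max_ideal :: "('n::finite, 'k::field) mpoly set" where
  "max_ideal = ideal.span (var ` UNIV)"

definition monomial_prime :: "('n::finite, 'k::field) mpoly set \<Rightarrow> bool" where
  "monomial_prime Q \<longleftrightarrow> (\<exists>A. Q = ideal.span (var ` A))"

definition irredundant_inter :: "nat \<Rightarrow> (nat \<Rightarrow> 'a set) \<Rightarrow> bool" where
  "irredundant_inter s P \<longleftrightarrow> (\<forall>i\<in>{1..s}. (\<Inter>j\<in>{1..s} - {i}. P j) \<noteq> (\<Inter>j\<in>{1..s}. P j))"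

text \<open>
  Sums of ideals are elementwise sums of sets, as provided by \<open>Set_Algebras\<close>. The set \<open>\<Q>\<close> ranges
  over the sets of \<open>t + 1\<close> distinct primes among \<open>P 1, \<dots>, P s\<close>.
\<close>

definition big_size :: "nat \<Rightarrow> (nat \<Rightarrow> ('n::finite, 'k::field) mpoly set) \<Rightarrow> nat" where
  "big_size s P =
    (LEAST t. t < s \<and> (\<forall>\<Q>. \<Q> \<subseteq> P ` {1..s} \<and> card \<Q> = t + 1 \<longrightarrow> (\<Sum>Q\<in>\<Q>. Q) = max_ideal))"

definition poly_subring :: "'n set \<Rightarrow> ('n, 'k::field) mpoly set" where
  "poly_subring Z = {f. \<forall>v\<in>Poly_Mapping.keys f. Poly_Mapping.keys v \<subseteq> Z}"

definition stanley_space :: "'n monom \<Rightarrow> 'n set \<Rightarrow> ('n, 'k::field) mpoly set" where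
  "stanley_space u Z = lin.span {monomial u * f | f. f \<in> poly_subring Z}"

definition is_direct_sum :: "'a::comm_monoid_add set \<Rightarrow> nat \<Rightarrow> (nat \<Rightarrow> 'a set) \<Rightarrow> bool" where
  "is_direct_sum W r V \<longleftrightarrow>
    W = (\<Sum>i<r. V i) \<and>
    (\<forall>f. (\<forall>i<r. f i \<in> V i) \<and> (\<Sum>i<r. f i) = 0 \<longrightarrow> (\<forall>i<r. f i = 0))"

definition stanley_decomposition ::
    "('n::finite, 'k::field) mpoly set \<Rightarrow> ('n monom \<times> 'n set) list \<Rightarrow> bool" where
  "stanley_decomposition I D \<longleftrightarrow>
    (\<forall>(u, Z)\<in>set D. monomial u \<in> I) \<and>
    is_direct_sum I (length D) (\<lambda>i. stanley_space (fst (D ! i)) (snd (D ! i)))"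

definition sdepth_decomp :: "('n monom \<times> 'n set) list \<Rightarrow> nat" where
  "sdepth_decomp D = Min ((\<lambda>(u, Z). card Z) ` set D)"

text \<open>
  For \<open>I \<noteq> 0\<close> every decomposition is a nonempty list, so the minimum above is meaningful and the
  set below is bounded by \<open>CARD('n)\<close>.
\<close>

definition sdepth :: "('n::finite, 'k::field) mpoly set \<Rightarrow> nat" where
  "sdepth I = Max {sdepth_decomp D | D. stanley_decomposition I D}"

text \<open>
  For a submodule (ideal) \<open>M\<close> of the ring, \<open>ideal.span (A * M)\<close>, with the elementwise product of
  \<open>Set_Algebras\<close>, is the submodule \<open>(A)M\<close>. Thus each \<open>a\<^sub>i\<close> is a nonzerodivisor on
  \<open>M / (a\<^sub>0, \<dots>, a\<^bsub>i-1\<^esub>)M\<close> and \<open>M / (a\<^sub>0, \<dots>, a\<^bsub>r-1\<^esub>)M\<close> is not zero.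
\<close>

definition regular_seq :: "'a::comm_ring_1 set \<Rightarrow> 'a list \<Rightarrow> bool" where
  "regular_seq M as \<longleftrightarrow>
    (\<forall>i<length as. \<forall>f\<in>M.
       as ! i * f \<in> ideal.span (set (take i as) * M) \<longrightarrow> f \<in> ideal.span (set (take i as) * M)) \<and>
    ideal.span (set as * M) \<noteq> M"

definition depth :: "'a::comm_ring_1 set \<Rightarrow> 'a set \<Rightarrow> enat" where
  "depth J M = Sup {enat (length as) | as. set as \<subseteq> J \<and> regular_seq M as}"

end

theory Submission
  imports Defs "HOL-Library.Disjoint_Sets"
begin

text \<open>
  Let \<open>P\<^sub>i\<close> be generated by the variables in \<open>A\<^sub>i\<close>. Big size one says that any two of the primes sum
  to the maximal ideal \<open>\<mm>\<close>, that is, \<open>A\<^sub>i \<union> A\<^sub>j\<close> contains every variable for \<open>i \<noteq> j\<close>. So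
  the complements of the \<open>A\<^sub>i\<close> are pairwise disjoint, and by irredundancy none of them is empty:
  \<open>I\<close> is the Stanley-Reisner ideal of a disjoint union of \<open>s \<ge> 2\<close> simplices, and such
  an \<open>I\<close> has depth 2. The proof consists of the two bounds
  \<open>depth I \<le> 2 \<le> sdepth I\<close>.

  \<^emph>\<open>Stanley depth\<close> (\<open>sdepth_squarefree_ge_2\<close>). A squarefree monomial ideal is the direct sum of the
  spaces \<open>x\<^sub>F K[F]\<close>, where \<open>F\<close> runs over the supports of its monomials. Only the singletons \<open>F\<close>
  are too small. Some variable \<open>y\<close> is not in \<open>I\<close>. Whenever \<open>F\<close> and \<open>F \<union> {y}\<close> are both supports
  and \<open>y \<notin> F\<close>, the two pieces together form \<open>x\<^sub>F K[F \<union> {y}]\<close>, and after this merging every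
  piece has at least two variables.

  \<^emph>\<open>Depth\<close> (\<open>regular_seq_length_le_2\<close>). Put \<open>J\<^sub>1 = P\<^sub>1\<close> and \<open>J\<^sub>2 = P\<^sub>2 \<inter> \<dots> \<inter> P\<^sub>s\<close>. Then
  \<open>I = J\<^sub>1 \<inter> J\<^sub>2\<close> and \<open>\<mm> = J\<^sub>1 + J\<^sub>2\<close>, so the punctured spectrum of \<open>S / I\<close> is disconnected and
  the idempotent that is 0 on one part and 1 on the other gives a nonzero class in the second
  local cohomology of \<open>I\<close>. Here is this class made explicit. Let \<open>a, b, c\<close> be the beginning of an
  \<open>I\<close>-regular sequence in \<open>\<mm>\<close>, and split \<open>a = a\<^sub>1 + a\<^sub>2\<close>, \<open>b = b\<^sub>1 + b\<^sub>2\<close> along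
  \<open>J\<^sub>1 + J\<^sub>2\<close>. The element \<open>w = a\<^sub>1 b\<^sub>2 - b\<^sub>1 a\<^sub>2\<close> of \<open>I\<close> satisfies \<open>\<mm> w \<subseteq> (a, b) I\<close>
  (\<open>koszul_cycle_killed\<close>), so regularity of \<open>c\<close> puts \<open>w\<close> in \<open>(a, b) I\<close>. Written out, and with
  the fact that a proportion \<open>b r = a t\<close> has only the obvious solutions
  (\<open>regular_pair_common_factor\<close>), this yields a polynomial \<open>h\<close> which behaves like that idempotent:
  \<open>h J\<^sub>2 \<subseteq> I\<close> and \<open>(1 - h) J\<^sub>1 \<subseteq> I\<close>. The first inclusion makes the constant coefficient
  of \<open>h\<close> zero and the second one makes it one.
\<close>

section \<open>Spaces spanned by monomials\<close>

text \<open>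
  For the ring acting on itself this rule reads \<open>a * (b * x) = (a * b) * x\<close>; together with the
  associativity in \<open>ac_simps\<close> it would make the simplifier loop.
\<close>
declare ideal.scale_scale [simp del]

definition monomial_space :: "'n monom set \<Rightarrow> ('n, 'k::field) mpoly set" where
  "monomial_space M = {f. Poly_Mapping.keys f \<subseteq> M}"

definition monoid_ideal :: "'n monom set \<Rightarrow> bool" where
  "monoid_ideal M \<longleftrightarrow> (\<forall>u\<in>M. \<forall>v. u + v \<in> M)"

lemma monomial_in_space_iff [simp]:
  "(monomial u :: ('n, 'k::field) mpoly) \<in> monomial_space M \<longleftrightarrow> u \<in> M"
  by (simp add: monomial_space_def monomial_def)

lemma monomial_space_eq_iff:
  fixes A B :: "'n monom set"
  shows "(monomial_space A :: ('n, 'k::field) mpoly set) = monomial_space B \<longleftrightarrow> A = B"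
proof
  assume eq: "(monomial_space A :: ('n, 'k) mpoly set) = monomial_space B"
  have "u \<in> A \<longleftrightarrow> u \<in> B" for u
    using eq monomial_in_space_iff[where 'k = 'k] by metis
  then show "A = B" by blast
qed simp

lemma monomial_space_Int: "monomial_space M \<inter> monomial_space N = monomial_space (M \<inter> N)"
  by (auto simp: monomial_space_def)

lemma lookup_monomial_times:
  fixes f :: "('n, 'k::field) mpoly"
  shows "Poly_Mapping.lookup (monomial u * f) (u + v) = Poly_Mapping.lookup f v"
proof -
  have "Poly_Mapping.lookup (monomial u * f) (u + v) =
      Sum_any (\<lambda>l. (1 when u = l) * Sum_any (\<lambda>q. Poly_Mapping.lookup f q when u + v = l + q))"
    by (simp add: lookup_mult monomial_def lookup_single)
  also have "\<dots> = Sum_any (\<lambda>l. Sum_any (\<lambda>q. Poly_Mapping.lookup f q when u + v = l + q) when l = u)"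
    by (rule Sum_any.cong) (auto simp: when_def)
  also have "\<dots> = Sum_any (\<lambda>q. Poly_Mapping.lookup f q when v = q)"
    by simp
  finally show ?thesis by simp
qed

lemma keys_monomial_times:
  fixes f :: "('n, 'k::field) mpoly"
  shows "Poly_Mapping.keys (monomial u * f) = (+) u ` Poly_Mapping.keys f"
proof
  show "Poly_Mapping.keys (monomial u * f) \<subseteq> (+) u ` Poly_Mapping.keys f"
    using keys_mult[of "monomial u" f] by (auto simp: monomial_def)
  show "(+) u ` Poly_Mapping.keys f \<subseteq> Poly_Mapping.keys (monomial u * f)"
    by (auto simp: in_keys_iff lookup_monomial_times)
qed

lemma monomial_times_cancel:
  fixes f g :: "('n, 'k::field) mpoly"
  assumes "monomial u * f = monomial u * g"
  shows "f = g"
  by (rule poly_mapping_eqI) (metis assms lookup_monomial_times)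

text \<open>
  The coefficient of \<open>u\<close> in \<open>u f\<close> is the constant coefficient of \<open>f\<close>. This is how membership
  in a monomial ideal determines the constant coefficient of the idempotent-like \<open>h\<close>.
\<close>
lemma constant_coeff_eq_0:
  fixes f :: "('n, 'k::field) mpoly"
  assumes "monomial u * f \<in> monomial_space M" and "u \<notin> M"
  shows "Poly_Mapping.lookup f 0 = 0"
proof -
  have "u \<notin> Poly_Mapping.keys (monomial u * f)"
    using assms unfolding monomial_space_def by blast
  then show ?thesis
    using lookup_monomial_times[of u f 0] by (simp add: in_keys_iff)
qed

lemma poly_eq_sum_singles:
  "f = (\<Sum>v\<in>Poly_Mapping.keys f. Poly_Mapping.single v (Poly_Mapping.lookup f v))"
  by (rule poly_mapping_eqI) (auto simp: lookup_sum lookup_single when_def in_keys_iff)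

lemma monomial_space_plus:
  "monomial_space A + monomial_space B = (monomial_space (A \<union> B) :: ('n, 'k::field) mpoly set)"
proof
  show "monomial_space A + monomial_space B \<subseteq> (monomial_space (A \<union> B) :: ('n, 'k) mpoly set)"
    using keys_add by (fastforce simp: monomial_space_def set_plus_def)
  show "(monomial_space (A \<union> B) :: ('n, 'k) mpoly set) \<subseteq> monomial_space A + monomial_space B"
  proof
    fix f :: "('n, 'k) mpoly"
    assume f: "f \<in> monomial_space (A \<union> B)"
    define part where
      "part V = (\<Sum>v\<in>V. Poly_Mapping.single v (Poly_Mapping.lookup f v))" for V
    have part: "part V \<in> monomial_space C" if "finite V" "V \<subseteq> C" for V C
      using that
      by (auto simp: part_def monomial_space_def lookup_sum lookup_single when_def in_keys_iff
          split: if_splits)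
    have "f = part (Poly_Mapping.keys f \<inter> A) + part (Poly_Mapping.keys f - A)"
      unfolding part_def
      by (subst (1) poly_eq_sum_singles) (rule sum.Int_Diff[OF finite_keys])
    moreover have "part (Poly_Mapping.keys f \<inter> A) \<in> monomial_space A"
      by (rule part) auto
    moreover have "part (Poly_Mapping.keys f - A) \<in> monomial_space B"
      using f by (intro part) (auto simp: monomial_space_def)
    ultimately show "f \<in> monomial_space A + monomial_space B"
      by (metis set_plus_intro)
  qed
qed

lemma subspace_monomial_space:
  fixes M :: "'n monom set"
  assumes "monoid_ideal M"
  shows "ideal.subspace (monomial_space M :: ('n, 'k::field) mpoly set)"
proof (rule ideal.subspaceI)
  fix x y :: "('n, 'k) mpoly"
  assume "x \<in> monomial_space M" "y \<in> monomial_space M"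
  then show "x + y \<in> monomial_space M"
    using keys_add[of x y] by (auto simp: monomial_space_def)
next
  fix c x :: "('n, 'k) mpoly"
  assume "x \<in> monomial_space M"
  then show "c * x \<in> monomial_space M"
    using keys_mult[of c x] assms
    by (fastforce simp: monomial_space_def monoid_ideal_def add.commute)
qed (simp add: monomial_space_def)

lemma span_vars:
  "ideal.span (var ` A) = (monomial_space {v. Poly_Mapping.keys v \<inter> A \<noteq> {}} :: ('n, 'k::field) mpoly set)"
    (is "_ = ?R")
proof
  have up: "monoid_ideal {v :: 'n monom. Poly_Mapping.keys v \<inter> A \<noteq> {}}"
    by (fastforce simp: monoid_ideal_def in_keys_iff lookup_add)
  show "ideal.span (var ` A) \<subseteq> ?R"
    by (rule ideal.span_minimal[OF _ subspace_monomial_space[OF up]]) (auto simp: var_def)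
  show "?R \<subseteq> ideal.span (var ` A)"
  proof
    fix f :: "('n, 'k) mpoly"
    assume f: "f \<in> ?R"
    have "Poly_Mapping.single v c \<in> ideal.span (var ` A)" if "v \<in> Poly_Mapping.keys f" for v and c :: 'k
    proof -
      have "Poly_Mapping.keys v \<inter> A \<noteq> {}"
        using f that unfolding monomial_space_def by blast
      then obtain i where i: "i \<in> A" "i \<in> Poly_Mapping.keys v" by blast
      have "v = (v - Poly_Mapping.single i 1) + Poly_Mapping.single i 1"
        using i(2) by (intro poly_mapping_eqI)
          (auto simp: lookup_add lookup_minus lookup_single when_def in_keys_iff)
      then have "Poly_Mapping.single v c = Poly_Mapping.single (v - Poly_Mapping.single i 1) c * var i"
        by (simp add: var_def monomial_def mult_single)
      then show ?thesis
        using i(1) by (simp add: ideal.span_scale ideal.span_base)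
    qed
    then show "f \<in> ideal.span (var ` A)"
      by (subst poly_eq_sum_singles) (intro ideal.span_sum)
  qed
qed

section \<open>Stanley decompositions\<close>

definition cone :: "'n monom \<Rightarrow> 'n set \<Rightarrow> 'n monom set" where
  "cone u Z = {u + v | v. Poly_Mapping.keys v \<subseteq> Z}"

lemma stanley_space_eq:
  "stanley_space u Z = (monomial_space (cone u Z) :: ('n, 'k::field) mpoly set)"
proof
  have "lin.subspace (monomial_space N :: ('n, 'k) mpoly set)" for N
  proof (rule lin.subspaceI)
    fix x y :: "('n, 'k) mpoly"
    assume "x \<in> monomial_space N" "y \<in> monomial_space N"
    then show "x + y \<in> monomial_space N"
      using keys_add[of x y] by (auto simp: monomial_space_def)
  next
    fix c and x :: "('n, 'k) mpoly"
    assume "x \<in> monomial_space N"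
    then show "scalar c x \<in> monomial_space N"
      using keys_mult[of "Poly_Mapping.single 0 c" x]
      by (fastforce simp: monomial_space_def scalar_def split: if_splits)
  qed (simp add: monomial_space_def)
  then show "stanley_space u Z \<subseteq> (monomial_space (cone u Z) :: ('n, 'k) mpoly set)"
    unfolding stanley_space_def
    by (intro lin.span_minimal)
      (auto simp: monomial_space_def keys_monomial_times cone_def poly_subring_def)
  show "(monomial_space (cone u Z) :: ('n, 'k) mpoly set) \<subseteq> stanley_space u Z"
  proof
    fix f :: "('n, 'k) mpoly"
    assume f: "f \<in> monomial_space (cone u Z)"
    have "Poly_Mapping.single w c \<in> stanley_space u Z" if w: "w \<in> Poly_Mapping.keys f" for w and c :: 'k
    proof -
      obtain v where v: "w = u + v" "Poly_Mapping.keys v \<subseteq> Z"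
        using f w by (auto simp: monomial_space_def cone_def)
      have "Poly_Mapping.single w c = monomial u * Poly_Mapping.single v c"
        by (simp add: v(1) monomial_def mult_single)
      moreover have "Poly_Mapping.single v c \<in> poly_subring Z"
        using v(2) by (simp add: poly_subring_def)
      ultimately show ?thesis
        unfolding stanley_space_def by (intro lin.span_base) blast
    qed
    then show "f \<in> stanley_space u Z"
      unfolding stanley_space_def
      by (subst poly_eq_sum_singles) (intro lin.span_sum)
  qed
qed

text \<open>
  The monomials form a basis, so direct sums of spaces spanned by monomials are partitions of
  sets of monomials. This reduces the search for a Stanley decomposition to combinatorics.
\<close>
lemma monomial_space_UN:
  fixes M :: "nat \<Rightarrow> 'n monom set"
  assumes disj: "disjoint_family_on M {..<r}"
  shows "is_direct_sum (monomial_space (\<Union>i<r. M i) :: ('n, 'k::field) mpoly set) r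
           (\<lambda>i. monomial_space (M i))"
  unfolding is_direct_sum_def
proof (intro conjI allI impI)
  show "monomial_space (\<Union>i<r. M i) = (\<Sum>i<r. monomial_space (M i) :: ('n, 'k) mpoly set)"
  proof (induction r)
    case 0
    show ?case by (auto simp: monomial_space_def)
  next
    case (Suc r)
    show ?case
      by (simp add: lessThan_Suc monomial_space_plus Un_commute flip: Suc.IH)
  qed
next
  fix f :: "nat \<Rightarrow> ('n, 'k) mpoly" and i
  assume f: "(\<forall>i<r. f i \<in> monomial_space (M i)) \<and> (\<Sum>i<r. f i) = 0" and i: "i < r"
  show "f i = 0"
  proof (rule poly_mapping_eqI)
    fix v
    show "Poly_Mapping.lookup (f i) v = Poly_Mapping.lookup 0 v"
    proof (cases "v \<in> M i")
      case True
      have "Poly_Mapping.lookup (f j) v = 0" if "j < r" "j \<noteq> i" for j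
      proof -
        have "v \<notin> M j"
          using disj True i that by (auto simp: disjoint_family_on_def)
        then show ?thesis
          using f that(1) unfolding monomial_space_def by (metis (lifting) in_keys_iff mem_Collect_eq subsetD)
      qed
      then have "(\<Sum>j<r. Poly_Mapping.lookup (f j) v) = (\<Sum>j\<in>{i}. Poly_Mapping.lookup (f j) v)"
        using i by (intro sum.mono_neutral_right) auto
      then show ?thesis
        using f by (simp flip: lookup_sum)
    next
      case False
      then show ?thesis
        using f i unfolding monomial_space_def
        by (metis (lifting) in_keys_iff lookup_zero mem_Collect_eq subsetD)
    qed
  qed
qed

text \<open>
  The Stanley depth is a maximum of natural numbers, so it bounds its members only because they are
  bounded. The zero ideal has to be excluded: it has the empty decomposition, whose minimum over
  the empty set is unspecified.
\<close>
lemma sdepth_ge_sdepth_decomp: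
  fixes I :: "('n::finite, 'k::field) mpoly set"
  assumes "stanley_decomposition I D" and "I \<noteq> {0}"
  shows "sdepth_decomp D \<le> sdepth I"
proof -
  have "sdepth_decomp D' \<le> card (UNIV :: 'n set)" if "stanley_decomposition I D'" for D'
  proof -
    have "D' \<noteq> []"
      using that assms(2) by (auto simp: stanley_decomposition_def is_direct_sum_def)
    then obtain p where "p \<in> set D'" by (cases D') auto
    then have "sdepth_decomp D' \<le> (\<lambda>(u, Z). card Z) p"
      unfolding sdepth_decomp_def by (intro Min_le) auto
    also have "\<dots> \<le> card (UNIV :: 'n set)"
      by (auto simp: card_mono split: prod.split)
    finally show ?thesis .
  qed
  then have "finite {sdepth_decomp D | D. stanley_decomposition I D}"
    by (intro finite_subset[OF _ finite_atMost[of "card (UNIV :: 'n set)"]]) blast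
  then show ?thesis
    unfolding sdepth_def by (rule Max_ge) (use assms(1) in blast)
qed

definition squarefree_monom :: "'n::finite set \<Rightarrow> 'n monom" where
  "squarefree_monom F = (\<Sum>i\<in>F. Poly_Mapping.single i 1)"

lemma lookup_squarefree_monom: "Poly_Mapping.lookup (squarefree_monom F) i = (if i \<in> F then 1 else 0)"
  by (simp add: squarefree_monom_def lookup_sum lookup_single when_def)

lemma keys_squarefree_monom [simp]: "Poly_Mapping.keys (squarefree_monom F) = F"
  by (auto simp: in_keys_iff lookup_squarefree_monom split: if_splits)

lemma cone_squarefree_monom:
  fixes F Z :: "'n::finite set"
  shows "F \<subseteq> Z \<Longrightarrow> cone (squarefree_monom F) Z = {v. F \<subseteq> Poly_Mapping.keys v \<and> Poly_Mapping.keys v \<subseteq> Z}"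
proof (intro equalityI subsetI)
  fix w :: "'n monom" assume "F \<subseteq> Z" "w \<in> cone (squarefree_monom F) Z"
  then show "w \<in> {v. F \<subseteq> Poly_Mapping.keys v \<and> Poly_Mapping.keys v \<subseteq> Z}"
    by (fastforce simp: cone_def in_keys_iff lookup_add lookup_squarefree_monom split: if_splits)
next
  fix w :: "'n monom" assume "F \<subseteq> Z" and w: "w \<in> {v. F \<subseteq> Poly_Mapping.keys v \<and> Poly_Mapping.keys v \<subseteq> Z}"
  have "w = squarefree_monom F + (w - squarefree_monom F)"
    using w by (intro poly_mapping_eqI)
      (auto simp: lookup_add lookup_minus lookup_squarefree_monom in_keys_iff subset_iff)
  moreover have "Poly_Mapping.keys (w - squarefree_monom F) \<subseteq> Z"
    using w by (auto simp: in_keys_iff lookup_minus)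
  ultimately show "w \<in> cone (squarefree_monom F) Z"
    unfolding cone_def by blast
qed

text \<open>
  A squarefree monomial ideal is given by the family \<open>G\<close> of the supports of its monomials, which is
  closed under supersets. The pieces are \<open>x\<^sub>F K[F \<union> {y}]\<close>, where \<open>F\<close> represents the pair of \<open>F\<close>
  and \<open>F \<union> {y}\<close>, or \<open>F\<close> alone if \<open>y \<in> F\<close> and \<open>F - {y}\<close> does not belong to \<open>G\<close>. Since
  neither \<open>{}\<close> nor \<open>{y}\<close> is in \<open>G\<close>, each \<open>F\<close> contains a variable other than \<open>y\<close>, so every
  piece has at least two variables.
\<close>
lemma sdepth_squarefree_ge_2:
  fixes G :: "'n::finite set set"
  assumes up: "\<And>F F'. F \<in> G \<Longrightarrow> F \<subseteq> F' \<Longrightarrow> F' \<in> G"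
    and "G \<noteq> {}" and y: "{y} \<notin> G"
  shows "sdepth (monomial_space {v. Poly_Mapping.keys v \<in> G} :: ('n, 'k::field) mpoly set) \<ge> 2"
    (is "sdepth ?I \<ge> 2")
proof -
  \<comment> \<open>the smallest member of each class of supports in \<open>G\<close> that differ at most in \<open>y\<close>\<close>
  define H where "H = {F \<in> G. y \<in> F \<longrightarrow> F - {y} \<notin> G}"
  have inj: "inj_on (\<lambda>F. F - {y}) H"
  proof (rule inj_onI)
    fix F F' assume F: "F \<in> H" "F' \<in> H" "F - {y} = F' - {y}"
    have "y \<in> F \<longleftrightarrow> y \<in> F'"
      using F unfolding H_def by (metis (no_types, lifting) Diff_empty Diff_insert0 mem_Collect_eq)
    then show "F = F'" using F(3) by blast
  qed
  obtain Fs where Fs: "set Fs = H" "distinct Fs"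
    using finite_distinct_list[of H] by auto
  define D where "D = map (\<lambda>F. (squarefree_monom F, insert y F)) Fs"
  have cone: "cone (squarefree_monom F) (insert y F) =
      {v. Poly_Mapping.keys v = F \<or> Poly_Mapping.keys v = insert y F}" for F :: "'n set"
    by (subst cone_squarefree_monom) auto
  have D_nth: "stanley_space (fst (D ! i)) (snd (D ! i)) =
      (monomial_space (cone (squarefree_monom (Fs ! i)) (insert y (Fs ! i))) :: ('n, 'k) mpoly set)"
    if "i < length Fs" for i
    using that by (simp add: D_def stanley_space_eq)
  have disj: "disjoint_family_on (\<lambda>i. cone (squarefree_monom (Fs ! i)) (insert y (Fs ! i))) {..<length Fs}"
  proof (rule ccontr)
    assume "\<not> ?thesis"
    then obtain i j v where ij: "i < length Fs" "j < length Fs" "i \<noteq> j"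
      and v: "v \<in> cone (squarefree_monom (Fs ! i)) (insert y (Fs ! i))"
        "v \<in> cone (squarefree_monom (Fs ! j)) (insert y (Fs ! j))"
      by (auto simp: disjoint_family_on_def)
    have "Fs ! i \<in> H" "Fs ! j \<in> H" "Fs ! i \<noteq> Fs ! j"
      using ij Fs by (auto simp: nth_eq_iff_index_eq)
    moreover have "Fs ! i - {y} = Fs ! j - {y}"
      using v unfolding cone by auto
    ultimately show False using inj by (meson inj_onD)
  qed
  have union: "(\<Union>i<length Fs. cone (squarefree_monom (Fs ! i)) (insert y (Fs ! i))) =
      {v. Poly_Mapping.keys v \<in> G}"
  proof -
    have "(\<Union>i<length Fs. cone (squarefree_monom (Fs ! i)) (insert y (Fs ! i))) =
        (\<Union>F\<in>H. cone (squarefree_monom F) (insert y F))"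
      unfolding Fs(1)[symmetric] set_conv_nth by auto
    also have "\<dots> = {v. Poly_Mapping.keys v \<in> G}"
    proof (intro equalityI subsetI)
      fix v assume "v \<in> (\<Union>F\<in>H. cone (squarefree_monom F) (insert y F))"
      then show "v \<in> {v. Poly_Mapping.keys v \<in> G}"
        unfolding cone H_def using up by blast
    next
      fix v :: "'n monom" assume "v \<in> {v. Poly_Mapping.keys v \<in> G}"
      then have v: "Poly_Mapping.keys v \<in> G" by simp
      show "v \<in> (\<Union>F\<in>H. cone (squarefree_monom F) (insert y F))"
      proof (cases "y \<in> Poly_Mapping.keys v \<and> Poly_Mapping.keys v - {y} \<in> G")
        case True
        then have "Poly_Mapping.keys v - {y} \<in> H" by (simp add: H_def)
        moreover have "Poly_Mapping.keys v = insert y (Poly_Mapping.keys v - {y})" using True by blast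
        ultimately show ?thesis unfolding cone by blast
      next
        case False
        then have "Poly_Mapping.keys v \<in> H" using v by (auto simp: H_def)
        then show ?thesis unfolding cone by blast
      qed
    qed
    finally show ?thesis .
  qed
  have dec: "stanley_decomposition ?I D"
    unfolding stanley_decomposition_def
  proof
    show "\<forall>(u, Z)\<in>set D. monomial u \<in> ?I"
      using Fs by (auto simp: D_def H_def)
    have "is_direct_sum ?I (length Fs)
        (\<lambda>i. monomial_space (cone (squarefree_monom (Fs ! i)) (insert y (Fs ! i))))"
      using monomial_space_UN[OF disj] unfolding union .
    then show "is_direct_sum ?I (length D) (\<lambda>i. stanley_space (fst (D ! i)) (snd (D ! i)))"
      by (simp add: is_direct_sum_def D_nth D_def stanley_space_eq cong: sum.cong_simp)
  qed
  have "UNIV \<in> G" using \<open>G \<noteq> {}\<close> up by blast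
  then have "monomial (squarefree_monom UNIV) \<in> ?I" by simp
  moreover have "monomial (squarefree_monom UNIV) \<noteq> (0 :: ('n, 'k) mpoly)"
    by (metis keys_single keys_zero monomial_def insert_not_empty one_neq_zero)
  ultimately have "?I \<noteq> {0}" by blast
  have "H \<noteq> {}"
    using \<open>UNIV \<in> G\<close> unfolding H_def by blast
  have "2 \<le> card (insert y F)" if "F \<in> H" for F
  proof -
    have F: "F \<in> G" "y \<in> F \<Longrightarrow> F - {y} \<notin> G" using that by (auto simp: H_def)
    then have "\<not> F \<subseteq> {y}" using y up by blast
    then obtain z where "z \<in> F" "z \<noteq> y" by blast
    then have "card {y, z} \<le> card (insert y F)" by (intro card_mono) auto
    then show ?thesis using \<open>z \<noteq> y\<close> by simp
  qed
  then have "2 \<le> sdepth_decomp D"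
    unfolding sdepth_decomp_def using Fs \<open>H \<noteq> {}\<close>
    by (subst Min_ge_iff) (auto simp: D_def)
  also have "\<dots> \<le> sdepth ?I"
    by (rule sdepth_ge_sdepth_decomp[OF dec \<open>?I \<noteq> {0}\<close>])
  finally show ?thesis .
qed

section \<open>Regular sequences on an intersection of two monomial ideals\<close>

lemma span_singleton_times:
  fixes M :: "'a::comm_ring_1 set"
  assumes "ideal.subspace M"
  shows "ideal.span ({a} * M) = {a * p | p. p \<in> M}"
proof (rule ideal.span_unique)
  show "{a} * M \<subseteq> {a * p | p. p \<in> M}" by (auto simp: set_times_def)
  show "ideal.subspace {a * p | p. p \<in> M}"
  proof (rule ideal.subspaceI)
    show "0 \<in> {a * p | p. p \<in> M}" using ideal.subspace_0[OF assms] by force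
    show "x + y \<in> {a * p | p. p \<in> M}" if x: "x \<in> {a * p | p. p \<in> M}" and y: "y \<in> {a * p | p. p \<in> M}" for x y
    proof -
      obtain p q where "x = a * p" "p \<in> M" "y = a * q" "q \<in> M" using x y by blast
      then have "x + y = a * (p + q)" "p + q \<in> M"
        by (simp_all only: distrib_left ideal.subspace_add[OF assms])
      then show ?thesis by blast
    qed
    show "c * x \<in> {a * p | p. p \<in> M}" if x: "x \<in> {a * p | p. p \<in> M}" for c x
    proof -
      obtain p where "x = a * p" "p \<in> M" using x by blast
      then have "c * x = a * (c * p)" "c * p \<in> M"
        by (simp_all only: mult.left_commute ideal.subspace_scale[OF assms])
      then show ?thesis by blast
    qed
  qed
  show "{a * p | p. p \<in> M} \<subseteq> T" if "{a} * M \<subseteq> T" for T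
    using that by (auto simp: set_times_def)
qed

lemma span_pair_times:
  fixes M :: "'a::comm_ring_1 set"
  assumes "ideal.subspace M"
  shows "ideal.span ({a, b} * M) = {a * p + b * q | p q. p \<in> M \<and> q \<in> M}"
proof -
  have "{a, b} * M = {a} * M \<union> {b} * M" by (auto simp: set_times_def)
  then have "ideal.span ({a, b} * M) = {x + y | x y. x \<in> ideal.span ({a} * M) \<and> y \<in> ideal.span ({b} * M)}"
    by (simp add: ideal.span_Un)
  then show ?thesis
    unfolding span_singleton_times[OF assms] by blast
qed

text \<open>
  If \<open>M\<close> spans an ideal, the fraction \<open>j / u\<close> maps this ideal into itself, so it is integral over
  the polynomial ring and has to be a polynomial. Because the denominator is a monomial, a direct
  argument suffices: for each variable, multiply \<open>j\<close> by a monomial of \<open>M\<close> whose exponent at this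
  variable is minimal.
\<close>
lemma monomial_multiplier_is_polynomial:
  fixes j :: "('n, 'k::field) mpoly"
  assumes "u \<in> M"
    and j: "\<And>w. w \<in> M \<Longrightarrow> \<exists>g\<in>monomial_space M. j * monomial w = monomial u * g"
  shows "\<exists>h. j = monomial u * h"
proof -
  have le: "Poly_Mapping.lookup u i \<le> Poly_Mapping.lookup v i" if v: "v \<in> Poly_Mapping.keys j" for v i
  proof -
    obtain w where w: "w \<in> M" "\<And>w'. w' \<in> M \<Longrightarrow> Poly_Mapping.lookup w i \<le> Poly_Mapping.lookup w' i"
      using ex_has_least_nat[of "\<lambda>w. w \<in> M" u "\<lambda>w. Poly_Mapping.lookup w i"] \<open>u \<in> M\<close> by blast
    obtain g where g: "g \<in> monomial_space M" "monomial w * j = monomial u * g"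
      using j[OF w(1)] by (auto simp: mult.commute)
    have "w + v \<in> (+) u ` Poly_Mapping.keys g"
      using v keys_monomial_times[of w j] keys_monomial_times[of u g] g(2) by auto
    then obtain w' where w': "w' \<in> M" "w + v = u + w'"
      using g(1) by (auto simp: monomial_space_def)
    then show ?thesis
      using w(2)[OF w'(1)] arg_cong[OF w'(2), of "\<lambda>x. Poly_Mapping.lookup x i"]
      unfolding lookup_add by linarith
  qed
  let ?h = "\<Sum>v\<in>Poly_Mapping.keys j. Poly_Mapping.single (v - u) (Poly_Mapping.lookup j v)"
  have "monomial u * ?h = (\<Sum>v\<in>Poly_Mapping.keys j. Poly_Mapping.single v (Poly_Mapping.lookup j v))"
    unfolding sum_distrib_left
  proof (rule sum.cong)
    fix v assume "v \<in> Poly_Mapping.keys j"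
    then have "u + (v - u) = v"
      using le by (intro poly_mapping_eqI) (simp add: lookup_add lookup_minus)
    then show "monomial u * Poly_Mapping.single (v - u) (Poly_Mapping.lookup j v) =
        Poly_Mapping.single v (Poly_Mapping.lookup j v)"
      by (simp add: monomial_def mult_single)
  qed simp
  then show ?thesis
    using poly_eq_sum_singles[of j] by metis
qed

text \<open>
  Two elements that begin a regular sequence on an ideal are coprime in the polynomial ring. To see
  this without unique factorization, use regularity on the ideal: for each \<open>u \<in> M\<close> it turns
  \<open>b (r u) = a (t u)\<close> into \<open>r u \<in> a I\<close>. Hence the fraction \<open>r / a = j / u\<close> maps the ideal into
  itself, so it is a polynomial \<open>h\<close>.
\<close>
lemma regular_pair_common_factor:
  fixes a b r t :: "('n, 'k::field) mpoly"
  defines "I M \<equiv> monomial_space M :: ('n, 'k) mpoly set"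
  assumes M: "monoid_ideal M" "M \<noteq> {}"
    and a: "\<And>f. f \<in> I M \<Longrightarrow> a * f = 0 \<Longrightarrow> f = 0"
    and b: "\<And>f g. f \<in> I M \<Longrightarrow> g \<in> I M \<Longrightarrow> b * f = a * g \<Longrightarrow> \<exists>p\<in>I M. f = a * p"
    and eq: "b * r = a * t"
  shows "\<exists>h. r = a * h \<and> t = b * h"
proof -
  note sub = subspace_monomial_space[OF M(1), where 'k = 'k, folded I_def]
  have mon: "f * monomial u \<in> I M" if "u \<in> M" for f u
    using that by (intro ideal.subspace_scale[OF sub]) (simp add: I_def)
  have div: "\<exists>p\<in>I M. r * monomial u = a * p" if "u \<in> M" for u
  proof (rule b[OF mon[OF that] mon[OF that]])
    show "b * (r * monomial u) = a * (t * monomial u)"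
      using eq by (metis mult.assoc)
  qed
  obtain u where u: "u \<in> M" using M(2) by blast
  obtain j where j: "j \<in> I M" "r * monomial u = a * j" using div[OF u] by blast
  have "\<exists>h. j = monomial u * h"
  proof (rule monomial_multiplier_is_polynomial[OF u])
    fix w assume w: "w \<in> M"
    obtain g where g: "g \<in> I M" "r * monomial w = a * g" using div[OF w] by blast
    have "a * (j * monomial w) = a * (monomial u * g)"
    proof -
      have "a * (j * monomial w) = (r * monomial u) * monomial w"
        by (simp only: j(2) mult.assoc)
      also have "\<dots> = monomial u * (r * monomial w)"
        by (simp only: ac_simps)
      also have "\<dots> = a * (monomial u * g)"
        by (simp only: g(2) mult.left_commute)
      finally show ?thesis .
    qed
    then have "a * (j * monomial w - monomial u * g) = 0"
      by (simp add: right_diff_distrib)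
    moreover have "j * monomial w - monomial u * g \<in> I M"
      by (intro ideal.subspace_diff[OF sub] mon w ideal.subspace_scale[OF sub] g)
    ultimately have "j * monomial w = monomial u * g"
      using a by fastforce
    then show "\<exists>g\<in>monomial_space M. j * monomial w = monomial u * g"
      using g(1) unfolding I_def by blast
  qed
  then obtain h where h: "j = monomial u * h" by blast
  have "monomial u * r = monomial u * (a * h)"
    using j(2) by (simp only: h mult.commute[of r] mult.left_commute)
  then have r: "r = a * h" by (rule monomial_times_cancel)
  have "a * (monomial u * (t - b * h)) = 0"
  proof -
    have "a * t = a * (b * h)"
      using eq r by (metis mult.left_commute)
    then have "a * (t - b * h) = 0" by (simp add: right_diff_distrib)
    then show ?thesis by (metis mult.left_commute mult_zero_right)
  qed
  moreover have "monomial u * (t - b * h) \<in> I M"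
    using mon[OF u, of "t - b * h"] by (simp add: mult.commute)
  ultimately have "monomial u * (t - b * h) = monomial u * 0"
    using a by simp
  then have "t - b * h = 0" by (rule monomial_times_cancel)
  then show ?thesis using r by auto
qed

text \<open>
  With \<open>w = a\<^sub>1 b\<^sub>2 - b\<^sub>1 a\<^sub>2\<close>, adding \<open>a\<^sub>2 b\<^sub>2\<close> or \<open>a\<^sub>1 b\<^sub>1\<close> to both products gives two
  expressions \<open>w = a b\<^sub>2 - b a\<^sub>2 = a\<^sub>1 b - b\<^sub>1 a\<close> in the ideal \<open>(a, b)\<close>. The first has its
  coefficients in \<open>J\<^sub>2\<close> and is good for multiplication by \<open>c\<^sub>1 \<in> J\<^sub>1\<close>, the second has them in
  \<open>J\<^sub>1\<close> and is good for \<open>c\<^sub>2 \<in> J\<^sub>2\<close>. In both cases the new coefficients are in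
  \<open>J\<^sub>1 \<inter> J\<^sub>2\<close>.
\<close>
lemma koszul_cycle_killed:
  fixes a1 a2 b1 b2 c1 c2 :: "'a::comm_ring_1"
  assumes "a = a1 + a2" "b = b1 + b2" "c = c1 + c2"
  shows "c * (a1 * b2 - b1 * a2) = a * (c1 * b2 - b1 * c2) + b * (a1 * c2 - c1 * a2)"
proof -
  define w where "w = a1 * b2 - b1 * a2"
  have w1: "w = a * b2 - b * a2" and w2: "w = a1 * b - b1 * a"
    using assms by (simp_all add: w_def algebra_simps)
  have "c * w = c1 * w + c2 * w"
    unfolding assms(3) by (rule distrib_right)
  also have "\<dots> = c1 * (a * b2 - b * a2) + c2 * (a1 * b - b1 * a)"
    using w1 w2 by simp
  also have "\<dots> = a * (c1 * b2 - b1 * c2) + b * (a1 * c2 - c1 * a2)"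
    by (simp add: algebra_simps)
  finally show ?thesis unfolding w_def .
qed

text \<open>
  The hypotheses say that the punctured spectrum of \<open>S / (J\<^sub>1 \<inter> J\<^sub>2)\<close> is the disjoint
  union of the closed sets of \<open>J\<^sub>1\<close> and \<open>J\<^sub>2\<close>. That neither ideal contains the other excludes the
  cases in which \<open>J\<^sub>1 \<inter> J\<^sub>2\<close> is just one of the two.
\<close>
lemma regular_seq_length_le_2:
  fixes J1 J2 :: "('n::finite, 'k::field) mpoly set"
  assumes J: "J1 = monomial_space M1" "J2 = monomial_space M2"
    and M: "monoid_ideal M1" "monoid_ideal M2"
    and nsub: "\<not> M1 \<subseteq> M2" "\<not> M2 \<subseteq> M1"
    and sum: "max_ideal \<subseteq> J1 + J2"
    and as: "set as \<subseteq> max_ideal" "regular_seq (J1 \<inter> J2) as"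
  shows "length as \<le> 2"
proof (rule ccontr)
  assume "\<not> ?thesis"
  then obtain a b c as' where as_eq: "as = a # b # c # as'"
    by (auto simp: not_le less_eq_Suc_le numeral_eq_Suc Suc_le_length_iff)
  define I where "I = J1 \<inter> J2"
  have IM: "I = monomial_space (M1 \<inter> M2)"
    by (simp add: I_def J monomial_space_Int)
  have M12: "monoid_ideal (M1 \<inter> M2)" using M by (auto simp: monoid_ideal_def)
  have sub1: "ideal.subspace J1" and sub2: "ideal.subspace J2"
    using M J subspace_monomial_space by auto
  have subI: "ideal.subspace I" unfolding I_def by (rule ideal.subspace_inter[OF sub1 sub2])
  have I12: "x * y \<in> I" if "x \<in> J1" "y \<in> J2" for x y
    unfolding I_def
    using that ideal.subspace_scale[OF sub2] ideal.subspace_scale[OF sub1] by (metis IntI mult.commute)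
  have empty_times: "{} * I = {}" by (auto simp: set_times_def)
  have reg: "f \<in> ideal.span (set (take i as) * I)"
    if "i < length as" "f \<in> I" "as ! i * f \<in> ideal.span (set (take i as) * I)" for i f
    using as(2) that by (auto simp: regular_seq_def I_def)
  have reg_a: "f = 0" if "f \<in> I" "a * f = 0" for f
    using reg[of 0 f] that by (simp add: as_eq empty_times)
  have reg_b: "\<exists>p\<in>I. f = a * p" if "f \<in> I" "g \<in> I" "b * f = a * g" for f g
    using reg[of 1 f] that by (auto simp: as_eq span_singleton_times[OF subI])
  have reg_c: "\<exists>p\<in>I. \<exists>q\<in>I. f = a * p + b * q"
    if "f \<in> I" "p \<in> I" "q \<in> I" "c * f = a * p + b * q" for f p q
    using reg[of 2 f] that by (auto simp: as_eq span_pair_times[OF subI])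
  obtain u1 u2 where u: "u1 \<in> M1" "u1 \<notin> M2" "u2 \<in> M2" "u2 \<notin> M1" using nsub by blast
  have ne: "M1 \<inter> M2 \<noteq> {}"
    using u M unfolding monoid_ideal_def by (metis IntI add.commute empty_iff)
  have split: "\<exists>x y. f = x + y \<and> x \<in> J1 \<and> y \<in> J2" if "f \<in> set as" for f
    using that as(1) sum by (meson set_plus_elim subsetD)
  obtain a1 a2 where a: "a = a1 + a2" "a1 \<in> J1" "a2 \<in> J2"
    using split[of a] by (auto simp: as_eq)
  obtain b1 b2 where b: "b = b1 + b2" "b1 \<in> J1" "b2 \<in> J2"
    using split[of b] by (auto simp: as_eq)
  obtain c1 c2 where c: "c = c1 + c2" "c1 \<in> J1" "c2 \<in> J2"
    using split[of c] by (auto simp: as_eq)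
  define w where "w = a1 * b2 - b1 * a2"
  have "w \<in> I" unfolding w_def by (intro ideal.subspace_diff[OF subI] I12 a b)
  moreover have "c * w = a * (c1 * b2 - b1 * c2) + b * (a1 * c2 - c1 * a2)"
    unfolding w_def by (rule koszul_cycle_killed[OF a(1) b(1) c(1)])
  moreover have "c1 * b2 - b1 * c2 \<in> I" "a1 * c2 - c1 * a2 \<in> I"
    by (intro ideal.subspace_diff[OF subI] I12 a b c)+
  ultimately obtain p q where pq: "p \<in> I" "q \<in> I" "w = a * p + b * q"
    using reg_c by blast
  have "b * (a1 - q) = a * (b1 + p)"
    using pq(3) by (simp add: w_def a b algebra_simps)
  then obtain h where h: "a1 - q = a * h" "b1 + p = b * h"
    using regular_pair_common_factor[OF M12 ne, of a b "a1 - q" "b1 + p"] reg_a reg_b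
    unfolding IM by blast
  \<comment> \<open>\<open>b (a k) = a (b k)\<close> puts \<open>a k\<close> in \<open>a I\<close>; a monomial of \<open>I\<close> then lets \<open>a\<close> cancel\<close>
  have cancel: "k \<in> I" if ak: "a * k \<in> I" and bk: "b * k \<in> I" for k
  proof -
    obtain i where i: "i \<in> I" "a * k = a * i"
      using reg_b[OF ak bk] by (auto simp: mult.left_commute)
    obtain v where v: "v \<in> M1 \<inter> M2" using ne by blast
    have "monomial v * (k - i) \<in> I"
      using ideal.subspace_scale[OF subI, of "monomial v" "k - i"] v
      by (subst mult.commute) (intro ideal.subspace_scale[OF subI], simp add: IM)
    moreover have "a * (monomial v * (k - i)) = 0"
    proof -
      have "a * (k - i) = 0" using i(2) by (simp add: right_diff_distrib)
      then show ?thesis by (metis mult.left_commute mult_zero_right)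
    qed
    ultimately have "monomial v * (k - i) = monomial v * 0" using reg_a by simp
    then have "k - i = 0" by (rule monomial_times_cancel)
    then show ?thesis using i by simp
  qed
  \<comment> \<open>\<open>a h\<close> and \<open>b h\<close> are \<open>a1\<close> and \<open>b1\<close> up to elements of \<open>I\<close>, so \<open>h\<close> acts as 0 modulo \<open>J1\<close> and as 1 modulo \<open>J2\<close>\<close>
  have h1: "a * h \<in> J1" "b * h \<in> J1"
    unfolding h[symmetric] using pq a b
    by (auto simp: I_def intro: ideal.subspace_diff[OF sub1] ideal.subspace_add[OF sub1])
  have "a * (1 - h) = a2 + q" "b * (1 - h) = b2 - p"
    using h by (simp_all add: a(1) b(1) algebra_simps)
  then have h2: "a * (1 - h) \<in> J2" "b * (1 - h) \<in> J2"
    using pq a b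
    by (auto simp: I_def intro: ideal.subspace_diff[OF sub2] ideal.subspace_add[OF sub2])
  have "monomial u2 * h \<in> I"
  proof (rule cancel)
    have u2: "monomial u2 \<in> J2" using u by (simp add: J)
    show "a * (monomial u2 * h) \<in> I" "b * (monomial u2 * h) \<in> I"
      using I12[OF h1(1) u2] I12[OF h1(2) u2] by (simp_all only: ac_simps)
  qed
  then have "monomial u2 * h \<in> monomial_space M1" by (simp add: I_def J)
  then have "Poly_Mapping.lookup h 0 = 0"
    using u(4) by (rule constant_coeff_eq_0)
  moreover have "monomial u1 * (1 - h) \<in> I"
  proof (rule cancel)
    have u1: "monomial u1 \<in> J1" using u by (simp add: J)
    show "a * (monomial u1 * (1 - h)) \<in> I" "b * (monomial u1 * (1 - h)) \<in> I"
      using I12[OF u1 h2(1)] I12[OF u1 h2(2)] by (simp_all only: mult.left_commute)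
  qed
  then have "monomial u1 * (1 - h) \<in> monomial_space M2" by (simp add: I_def J)
  then have "Poly_Mapping.lookup (1 - h) 0 = 0"
    using u(2) by (rule constant_coeff_eq_0)
  ultimately show False by (simp add: lookup_minus)
qed

section \<open>Big size one\<close>

text \<open>
  The least number in the definition of the big size has the defining property only if some number
  has it. The number \<open>s - 1\<close> does: \<open>s\<close> distinct primes among \<open>P 1, \<dots>, P s\<close> are all of them.
\<close>
lemma big_size_1_imp_pairwise_comaximal:
  fixes P :: "nat \<Rightarrow> ('n::finite, 'k::field) mpoly set"
  assumes "s \<ge> 2" "(\<Sum>i\<in>{1..s}. P i) = max_ideal" "big_size s P = 1"
    and ij: "i \<in> {1..s}" "j \<in> {1..s}" "P i \<noteq> P j"
  shows "P i + P j = max_ideal"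
proof -
  let ?Q = "\<lambda>t. t < s \<and> (\<forall>\<Q>. \<Q> \<subseteq> P ` {1..s} \<and> card \<Q> = t + 1 \<longrightarrow> (\<Sum>Q\<in>\<Q>. Q) = max_ideal)"
  have "(\<Sum>Q\<in>\<Q>. Q) = max_ideal" if \<Q>: "\<Q> \<subseteq> P ` {1..s}" "card \<Q> = s" for \<Q>
  proof -
    have "card (P ` {1..s}) \<le> s" using card_image_le[of "{1..s}" P] by simp
    then have eq: "\<Q> = P ` {1..s}"
      using \<Q> by (intro card_seteq) auto
    then have "inj_on P {1..s}" using \<Q>(2) by (intro eq_card_imp_inj_on) auto
    then show ?thesis using assms(2) by (simp add: eq sum.reindex)
  qed
  then have "?Q (s - 1)" using \<open>s \<ge> 2\<close> by auto
  then have "?Q (big_size s P)" unfolding big_size_def by (rule LeastI)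
  then have "(\<Sum>Q\<in>{P i, P j}. Q) = max_ideal"
    unfolding assms(3) using ij by (auto simp: card_insert_if)
  then show ?thesis using ij(3) by simp
qed

theorem corollary1p7:
  fixes P :: "nat \<Rightarrow> ('n::finite, 'k::field) mpoly set"
    and I :: "('n, 'k) mpoly set"
    and s :: nat
  assumes "s \<ge> 2"
    and "\<And>i. i \<in> {1..s} \<Longrightarrow> monomial_prime (P i)"
    and "I = (\<Inter>i\<in>{1..s}. P i)"
    and "irredundant_inter s P"
    and "(\<Sum>i\<in>{1..s}. P i) = max_ideal"
    and "big_size s P = 1"
  shows "sdepth I \<ge> 2 \<and> enat (sdepth I) \<ge> depth max_ideal I"
proof -
  define N where "N A = {v :: 'n monom. Poly_Mapping.keys v \<inter> A \<noteq> {}}" for A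
  have N_mono: "monoid_ideal (N A)" for A
    by (fastforce simp: monoid_ideal_def N_def in_keys_iff lookup_add)
  have var_N: "Poly_Mapping.single v 1 \<in> N A \<longleftrightarrow> v \<in> A" for v A
    by (simp add: N_def)
  obtain A where A: "\<And>i. i \<in> {1..s} \<Longrightarrow> P i = monomial_space (N (A i))"
    using assms(2) unfolding monomial_prime_def span_vars N_def by metis
  have max: "(max_ideal :: ('n, 'k) mpoly set) = monomial_space (N UNIV)"
    by (simp add: max_ideal_def span_vars N_def)
  have nsub: "\<not> A j \<subseteq> A i" if ij: "i \<in> {1..s}" "j \<in> {1..s}" "i \<noteq> j" for i j
  proof
    assume "A j \<subseteq> A i"
    then have "P j \<subseteq> P i" using ij by (auto simp: A monomial_space_def N_def)
    then have "(\<Inter>k\<in>{1..s} - {i}. P k) = (\<Inter>k\<in>{1..s}. P k)" using ij by blast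
    then show False using assms(4) ij(1) by (auto simp: irredundant_inter_def)
  qed
  have cover: "v \<in> A i \<or> v \<in> A j" if ij: "i \<in> {1..s}" "j \<in> {1..s}" "i \<noteq> j" for i j v
  proof -
    have "P i \<noteq> P j"
    proof
      assume eq: "P i = P j"
      have "w \<in> A i" if "w \<in> A j" for w
        using that eq ij A var_N monomial_in_space_iff by metis
      then show False using nsub[OF ij] by blast
    qed
    then have "monomial_space (N (A i) \<union> N (A j)) = (monomial_space (N UNIV) :: ('n, 'k) mpoly set)"
      using big_size_1_imp_pairwise_comaximal[OF assms(1,5,6) ij(1,2)]
      by (simp add: max A[OF ij(1)] A[OF ij(2)] monomial_space_plus)
    then have "N (A i) \<union> N (A j) = N UNIV"
      unfolding monomial_space_eq_iff .
    then have "Poly_Mapping.single v 1 \<in> N (A i) \<union> N (A j)"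
      by (simp only: var_N UNIV_I)
    then show ?thesis
      by (simp only: Un_iff var_N)
  qed
  have s12: "1 \<in> {1..s}" "2 \<in> {1..s}" using \<open>s \<ge> 2\<close> by auto
  \<comment> \<open>a variable outside \<open>P 1\<close>, hence outside \<open>I\<close>\<close>
  obtain y where y: "y \<notin> A 1" using nsub[of 1 2] s12 by auto
  define G where "G = {F. \<forall>i\<in>{1..s}. F \<inter> A i \<noteq> {}}"
  have IG: "I = monomial_space {v. Poly_Mapping.keys v \<in> G}"
    unfolding assms(3) by (auto simp: A monomial_space_def N_def G_def)
  have "sdepth I \<ge> 2"
    unfolding IG
  proof (rule sdepth_squarefree_ge_2)
    show "F' \<in> G" if "F \<in> G" "F \<subseteq> F'" for F F' using that by (fastforce simp: G_def)
    show "{y} \<notin> G" using y s12 by (auto simp: G_def)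
    have "A i \<noteq> {}" if "i \<in> {1..s}" for i
      using nsub[of 1 i] nsub[of 2 i] that s12 by (cases "i = 1") auto
    then show "G \<noteq> {}" by (auto simp: G_def intro: exI[of _ UNIV])
  qed
  moreover have "depth max_ideal I \<le> 2"
    unfolding depth_def
  proof (rule Sup_least, clarify)
    fix as :: "('n, 'k) mpoly list"
    assume as: "set as \<subseteq> max_ideal" "regular_seq I as"
    define M2 where "M2 = (\<Inter>i\<in>{2..s}. N (A i))"
    have P2: "(\<Inter>i\<in>{2..s}. P i) = monomial_space M2"
      unfolding M2_def using s12 by (auto simp: A monomial_space_def)
    have "{1..s} = insert 1 {2..s}" using s12 by auto
    then have I12: "I = P 1 \<inter> (\<Inter>i\<in>{2..s}. P i)" unfolding assms(3) by simp
    have "length as \<le> 2"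
    proof (rule regular_seq_length_le_2[OF A[OF s12(1)] P2 N_mono _ _ _ _ as(1)])
      show "monoid_ideal M2" using N_mono by (auto simp: M2_def monoid_ideal_def)
      show "\<not> N (A 1) \<subseteq> M2"
      proof
        assume sub: "N (A 1) \<subseteq> M2"
        have "A 1 \<subseteq> A 2"
          using sub s12 by (fastforce simp: M2_def simp flip: var_N)
        then show False using nsub[of 2 1] s12 by simp
      qed
      have rest: "v \<in> A i" if "v \<notin> A 1" "i \<in> {2..s}" for v i
        using cover[of 1 i v] s12 that by auto
      have "Poly_Mapping.single y 1 \<in> M2"
        using rest[OF y] unfolding M2_def by (simp only: INT_iff var_N) blast
      moreover have "Poly_Mapping.single y 1 \<notin> N (A 1)"
        using y by (simp only: var_N) blast
      ultimately show "\<not> M2 \<subseteq> N (A 1)" by blast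
      have "N UNIV \<subseteq> N (A 1) \<union> M2"
        using rest unfolding N_def M2_def by blast
      then show "max_ideal \<subseteq> P 1 + (\<Inter>i\<in>{2..s}. P i)"
        unfolding P2 A[OF s12(1)] max monomial_space_plus
        by (auto simp: monomial_space_def)
      show "regular_seq (P 1 \<inter> (\<Inter>i\<in>{2..s}. P i)) as"
        using as(2) by (simp add: I12)
    qed
    then show "enat (length as) \<le> 2" by (simp add: numeral_eq_enat)
  qed
  ultimately show ?thesis
    by (metis enat_ord_simps(1) numeral_eq_enat order_trans)
qed

end
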